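(* Let $R^*\in\mathrm{SO}(3)$ and $M = R^* + \sigma N$, where $\sigma>0$ and $N\in\mathbb{R}^{3\times 3}$ has i.i.d. entries $N_{ij}\sim\mathcal{N}(0,1)$. Then, as $\sigma\to 0$, $$\frac{\mathbb{E}\big[\lVert \mathrm{SVDO}^+(M) - R^*\rVert_F^2\big]}{\mathbb{E}\big[\lVert M - R^*\rVert_F^2\big]} = \frac{3\sigma^2 + O(\sigma^3)}{9\sigma^2} = \frac13 + O(\sigma).$$ In particular, writing $\epsilon^2 = \mathbb{E}[\lVert M-R^*\rVert_F^2]$ and $\hat R = \mathrm{SVDO}^+(M)$, one has $\mathbb{E}[\lVert\hat R - R^*\rVert_F^2] \le \epsilon^2$ for all sufficiently small $\sigma$.
   Context: For $M\in\mathbb{R}^{3\times 3}$ with singular value decomposition $M = U\Sigma V^\top$ (singular values in decreasing order), $\mathrm{SVDO}^+(M) := U\,\mathrm{diag}(1,1,\det(UV^\top))\,V^\top \in \mathrm{SO}(3)$; it is a minimizer of $\lVert R - M\rVert_F^2$ over $R\in\mathrm{SO}(3)$ (well defined for almost every $M$). $\lVert\cdot\rVert_F$ is the Frobenius norm. *)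

theory Defs
  imports "HOL-Probability.Probability" "HOL-Library.Landau_Symbols"
begin

definition diag_mat :: "real ^ 'n \<Rightarrow> real ^ 'n ^ 'n" where
  "diag_mat d = (\<chi> i j. if i = j then d $ i else 0)"

definition is_svd :: "real^3^3 \<Rightarrow> real^3^3 \<Rightarrow> real^3 \<Rightarrow> real^3^3 \<Rightarrow> bool" where
  "is_svd M U s V \<longleftrightarrow>
     orthogonal_matrix U \<and> orthogonal_matrix V \<and>
     s $ 1 \<ge> s $ 2 \<and> s $ 2 \<ge> s $ 3 \<and> s $ 3 \<ge> 0 \<and>
     M = U ** diag_mat s ** transpose V"

definition is_svdo_plus :: "real^3^3 \<Rightarrow> real^3^3 \<Rightarrow> bool" where
  "is_svdo_plus M R \<longleftrightarrow>
     (\<exists>U s V. is_svd M U s V \<and>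
        R = U ** diag_mat (vector [1, 1, det (U ** transpose V)]) ** transpose V)"

(* The singular value decomposition is not unique, but the matrix in is_svdo_plus is the same
   for all decompositions of M unless the two smallest singular values coincide and det M \<le> 0.
   On this null set of exceptional M the identity matrix is taken by convention, so that the
   function is total, SO(3)-valued, and does not depend on arbitrary choices (an arbitrary
   choice on a null set need not be Borel measurable). *)
definition svdo_plus :: "real^3^3 \<Rightarrow> real^3^3" where
  "svdo_plus M =
     (if \<exists>!R. is_svdo_plus M R then (THE R. is_svdo_plus M R) else mat 1)"

(* The norm of the type real^'n^'m is the Frobenius norm. *)
lemma norm_matrix_eq_Frobenius:
  fixes A :: "real ^ 'n ^ 'm"
  shows "norm A = sqrt (\<Sum>i\<in>UNIV. \<Sum>j\<in>UNIV. (A $ i $ j)\<^sup>2)"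
  by (simp add: norm_vec_def L2_set_def sum_nonneg)

end

theory Submission
  imports Defs
begin

text \<open>If \<open>det M > 0\<close> and \<open>R = SVDO\<^sup>+(M)\<close>, then \<open>R\<^sup>T M\<close> is symmetric positive definite, so \<open>R\<close> is
  the strict maximizer of \<open>\<langle>R, M\<rangle>\<close> among orthogonal matrices; comparing with \<open>R\<^sup>*\<close> yields
  \<open>\<parallel>R - R\<^sup>*\<parallel> \<le> 2 \<parallel>M - R\<^sup>*\<parallel>\<close>. Feeding this bound into the symmetry of \<open>R\<^sup>T M\<close> and the orthogonality
  of \<open>R\<close> shows that \<open>R\<^sup>*\<^sup>T R - 1\<close> is the skew part of \<open>\<sigma> R\<^sup>*\<^sup>T N\<close> up to \<open>O(\<sigma>\<^sup>2 \<parallel>N\<parallel>\<^sup>2)\<close>, where the skew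
  part of \<open>R\<^sup>*\<^sup>T N\<close> has mean square norm \<open>3\<close>. For large noise the error is bounded while
  \<open>\<parallel>\<sigma> N\<parallel>\<^sup>3\<close> is bounded below, so the squared error differs from the squared norm of
  the skew part by \<open>O(\<sigma>\<^sup>3 \<parallel>N\<parallel>\<^sup>3)\<close> everywhere, and the third moment of \<open>\<parallel>N\<parallel>\<close> is finite. Measurability of
  \<open>SVDO\<^sup>+\<close> follows from the closed graph of the underlying relation and the compactness
  of the orthogonal group.\<close>

section \<open>Orthogonal matrices and the Frobenius inner product\<close>

lemma inner_matrix_eq_trace:
  fixes A B :: "real^'n^'m"
  shows "inner A B = trace (transpose A ** B)"
  unfolding inner_vec_def trace_def matrix_matrix_mult_def transpose_def
  by (simp, rule sum.swap)

lemma inner_matrix_mult_left: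
  fixes A :: "real^'k^'m" and B :: "real^'n^'k" and C :: "real^'n^'m"
  shows "inner (A ** B) C = inner B (transpose A ** C)"
  by (simp add: inner_matrix_eq_trace matrix_transpose_mul matrix_mul_assoc)

lemma inner_transpose_transpose:
  fixes A B :: "real^'n^'m"
  shows "inner (transpose A) (transpose B) = inner A B"
  unfolding inner_vec_def transpose_def by (simp, rule sum.swap)

lemma inner_matrix_mult_right:
  fixes A :: "real^'k^'m" and B :: "real^'n^'k" and C :: "real^'n^'m"
  shows "inner (A ** B) C = inner A (C ** transpose B)"
proof -
  have "inner (A ** B) C = inner (transpose B ** transpose A) (transpose C)"
    by (metis inner_transpose_transpose matrix_transpose_mul)
  also have "\<dots> = inner (transpose A) (transpose (C ** transpose B))"
    by (simp add: inner_matrix_mult_left matrix_transpose_mul)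
  finally show ?thesis by (simp add: inner_transpose_transpose)
qed

lemma norm_transpose [simp]: "norm (transpose A) = norm A" for A :: "real^'n^'m"
  by (simp add: norm_eq_sqrt_inner inner_transpose_transpose)

lemma norm_orthogonal_mult:
  fixes Q :: "real^'m^'m" and A :: "real^'n^'m"
  assumes "orthogonal_matrix Q"
  shows "norm (Q ** A) = norm A"
  using assms
  by (simp add: norm_eq_sqrt_inner inner_matrix_mult_left matrix_mul_assoc orthogonal_matrix)

lemma norm_orthogonal_matrix:
  fixes Q :: "real^'n^'n"
  assumes "orthogonal_matrix Q"
  shows "norm Q = sqrt (real CARD('n))"
  using assms by (simp add: norm_eq_sqrt_inner inner_matrix_eq_trace orthogonal_matrix trace_def mat_def)

text \<open>Every entry of the product is an inner product of a row of \<open>A\<close> with a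
  column of \<open>B\<close>; Cauchy-Schwarz entry by entry, then factoring the double sum, gives
  submultiplicativity.\<close>

lemma norm_matrix_mult_le:
  fixes A :: "real^'k^'m" and B :: "real^'n^'k"
  shows "norm (A ** B) \<le> norm A * norm B"
proof (rule power2_le_imp_le)
  have entry: "(A ** B) $ i $ j = inner (A $ i) (transpose B $ j)" for i j
    by (simp add: matrix_matrix_mult_def inner_vec_def transpose_def)
  have sq: "(norm C)\<^sup>2 = (\<Sum>i\<in>UNIV. (norm (C $ i))\<^sup>2)" for C :: "real^'p^'q"
    by (simp add: norm_vec_def L2_set_def sum_nonneg)
  have "(norm (A ** B))\<^sup>2 = (\<Sum>i\<in>UNIV. \<Sum>j\<in>UNIV. (inner (A $ i) (transpose B $ j))\<^sup>2)"
    by (simp add: norm_matrix_eq_Frobenius sum_nonneg entry)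
  also have "\<dots> \<le> (\<Sum>i\<in>UNIV. \<Sum>j\<in>UNIV. (norm (A $ i))\<^sup>2 * (norm (transpose B $ j))\<^sup>2)"
    by (intro sum_mono) (simp add: Cauchy_Schwarz_ineq power2_norm_eq_inner)
  also have "\<dots> = (norm A)\<^sup>2 * (norm (transpose B))\<^sup>2"
    by (simp add: sq sum_product del: norm_transpose)
  finally show "(norm (A ** B))\<^sup>2 \<le> (norm A * norm B)\<^sup>2"
    by (simp add: power_mult_distrib)
qed simp

lemma transpose_diff: "transpose (A - B) = transpose A - transpose B"
  for A B :: "'a::ab_group_add^'n^'m"
  by (simp add: transpose_def vec_eq_iff)

lemma matrix_add_rdistrib: "(B + C) ** A = B ** A + C ** A"
  for A :: "'a::semiring_1^'n^'k" and B C :: "'a^'k^'m"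
  by (simp add: matrix_matrix_mult_def vec_eq_iff sum.distrib distrib_right)

lemma matrix_diff_ldistrib: "A ** (B - C) = A ** B - A ** C"
  for A :: "'a::ring_1^'k^'m" and B C :: "'a^'n^'k"
  by (simp add: matrix_matrix_mult_def vec_eq_iff sum_subtractf right_diff_distrib)

lemma matrix_diff_rdistrib: "(B - C) ** A = B ** A - C ** A"
  for A :: "'a::ring_1^'n^'k" and B C :: "'a^'k^'m"
  by (simp add: matrix_matrix_mult_def vec_eq_iff sum_subtractf left_diff_distrib)

section \<open>Continuity of matrix operations and compactness of the orthogonal group\<close>

lemma continuous_on_matrix_mult [continuous_intros]:
  fixes f :: "'a::topological_space \<Rightarrow> real^'k^'m" and g :: "'a \<Rightarrow> real^'n^'k"
  assumes "continuous_on S f" "continuous_on S g"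
  shows "continuous_on S (\<lambda>x. f x ** g x)"
  unfolding matrix_matrix_mult_def by (intro continuous_intros assms)

lemma continuous_on_transpose [continuous_intros]:
  fixes f :: "'a::topological_space \<Rightarrow> real^'n^'m"
  assumes "continuous_on S f"
  shows "continuous_on S (\<lambda>x. transpose (f x))"
  unfolding transpose_def by (intro continuous_intros assms)

lemma continuous_on_det3 [continuous_intros]:
  fixes f :: "'a::topological_space \<Rightarrow> real^3^3"
  assumes "continuous_on S f"
  shows "continuous_on S (\<lambda>x. det (f x))"
  unfolding det_3 by (intro continuous_intros assms)

lemma compact_orthogonal_matrices: "compact {Q :: real^'n^'n. orthogonal_matrix Q}"
proof -
  have "closed {Q :: real^'n^'n. orthogonal_matrix Q}"
    unfolding orthogonal_matrix by (intro closed_Collect_eq continuous_intros)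
  moreover have "bounded {Q :: real^'n^'n. orthogonal_matrix Q}"
    by (rule boundedI[where B = "sqrt (real CARD('n))"]) (simp add: norm_orthogonal_matrix)
  ultimately show ?thesis by (simp add: compact_eq_bounded_closed)
qed

section \<open>Singular value decompositions\<close>

lemma diag_mat_nth [simp]: "diag_mat d $ i $ j = (if i = j then d $ i else 0)"
  by (simp add: diag_mat_def)

lemma det_diag_mat3: "det (diag_mat d) = d $ 1 * d $ 2 * d $ 3" for d :: "real^3"
  by (simp add: det_3)

lemma transpose_diag_mat [simp]: "transpose (diag_mat d) = diag_mat d"
  by (simp add: transpose_def vec_eq_iff)

lemma matrix_mult_diag_mat_nth: "(A ** diag_mat d) $ i $ j = A $ i $ j * d $ j"
  by (simp add: matrix_matrix_mult_def if_distrib cong: if_cong)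

lemma orthogonal_diag_mat3:
  fixes d :: "real^3"
  assumes "\<And>i. \<bar>d $ i\<bar> = 1"
  shows "orthogonal_matrix (diag_mat d)"
proof -
  have "d $ i * d $ i = 1" for i
    using assms[of i] by (metis abs_mult_self_eq mult_1)
  then show ?thesis
    by (simp add: orthogonal_matrix vec_eq_iff matrix_matrix_mult_def mat_def forall_3 sum_3)
qed

text \<open>The correcting determinant is 1 or -1, so the middle factor is a diagonal sign
  matrix.\<close>

lemma is_svdo_plus_orthogonal:
  assumes "is_svdo_plus M R"
  shows "orthogonal_matrix R"
proof -
  obtain U V where UV: "orthogonal_matrix U" "orthogonal_matrix V"
    and R: "R = U ** diag_mat (vector [1, 1, det (U ** transpose V)]) ** transpose V"
    using assms by (auto simp: is_svdo_plus_def is_svd_def)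
  have "orthogonal_matrix (U ** transpose V)"
    using UV by (intro orthogonal_matrix_mul) simp_all
  then have "\<bar>det (U ** transpose V)\<bar> = 1"
    using det_orthogonal_matrix[of "U ** transpose V"] by auto
  then have "orthogonal_matrix (diag_mat (vector [1, 1, det (U ** transpose V)] :: real^3))"
    by (intro orthogonal_diag_mat3) (rule forall_3[THEN iffD2, rule_format], simp)
  with UV show ?thesis
    unfolding R by (intro orthogonal_matrix_mul) simp_all
qed

text \<open>This covers the default value \<open>mat 1\<close> as well, so the error stays bounded
  even where the projection is ambiguous.\<close>

lemma svdo_plus_orthogonal: "orthogonal_matrix (svdo_plus M)"
  unfolding svdo_plus_def
  by (auto intro: is_svdo_plus_orthogonal[OF theI'] simp: orthogonal_matrix_id)

text \<open>A first-order optimality condition without derivatives: the rational parametrization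
  \<open>((1 - t^2)/(1 + t^2), 2t/(1 + t^2))\<close> of the circle turns the hypothesis into
  \<open>t * d \<le> t^2 * k\<close> for all \<open>t\<close>, which fails for small
  \<open>t\<close> of the sign of \<open>d\<close> unless \<open>d = 0\<close>.\<close>

lemma linear_le_quadratic_imp_zero:
  fixes d k :: real
  assumes "\<And>c s. c\<^sup>2 + s\<^sup>2 = 1 \<Longrightarrow> s * d \<le> (1 - c) * k"
  shows "d = 0"
proof (rule ccontr)
  assume "d \<noteq> 0"
  have "t * d \<le> t\<^sup>2 * k" for t
  proof -
    have pos: "1 + t\<^sup>2 > 0" by (simp add: add_pos_nonneg)
    have "(1 - t\<^sup>2)\<^sup>2 + (2 * t)\<^sup>2 = (1 + t\<^sup>2)\<^sup>2"
      by (simp add: power2_eq_square algebra_simps)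
    then have "((1 - t\<^sup>2) / (1 + t\<^sup>2))\<^sup>2 + (2 * t / (1 + t\<^sup>2))\<^sup>2 = 1"
      using pos by (simp add: power_divide flip: add_divide_distrib)
    from assms[OF this]
    have "2 * t / (1 + t\<^sup>2) * d \<le> (1 - (1 - t\<^sup>2) / (1 + t\<^sup>2)) * k" .
    moreover have "1 - (1 - t\<^sup>2) / (1 + t\<^sup>2) = 2 * t\<^sup>2 / (1 + t\<^sup>2)"
      using pos by (simp add: field_simps)
    ultimately have "(2 * (t * d)) / (1 + t\<^sup>2) \<le> (2 * (t\<^sup>2 * k)) / (1 + t\<^sup>2)"
      by simp
    with pos show ?thesis by (simp only: divide_le_cancel) auto
  qed
  \<comment> \<open>The value \<open>t = e * d\<close> has the sign of \<open>d\<close>; the summand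
    1 keeps the denominator positive and makes \<open>e * k < 1\<close> strict.\<close>
  define e where "e = 1 / (\<bar>k\<bar> + 1)"
  have e: "e > 0" "e * k < 1" by (auto simp: e_def field_simps)
  have "(e * d\<^sup>2) * 1 \<le> (e * d\<^sup>2) * (e * k)"
    using \<open>\<And>t. t * d \<le> t\<^sup>2 * k\<close>[of "e * d"] by (simp add: power2_eq_square mult_ac)
  moreover have "0 < e * d\<^sup>2" using e(1) \<open>d \<noteq> 0\<close> by simp
  ultimately have "1 \<le> e * k" by (simp only: mult_le_cancel_left_pos)
  with e(2) show False by simp
qed

text \<open>Each off-diagonal difference is the derivative of \<open>\<langle>Q, B\<rangle>\<close> at the identity along
  the rotations \<open>Q\<close> about one coordinate axis.\<close>

lemma symmetric_if_trace_maximal: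
  fixes B :: "real^3^3"
  assumes max: "\<And>Q. orthogonal_matrix Q \<Longrightarrow> inner Q B \<le> inner (mat 1) B"
  shows "transpose B = B"
proof -
  define rot where "rot c s = (vector [vector [c, -s, 0], vector [s, c, 0], vector [0, 0, 1]] :: real^3^3)" for c s
  define rot' where "rot' c s = (vector [vector [c, 0, -s], vector [0, 1, 0], vector [s, 0, c]] :: real^3^3)" for c s
  define rot'' where "rot'' c s = (vector [vector [1, 0, 0], vector [0, c, -s], vector [0, s, c]] :: real^3^3)" for c s
  note defs = rot_def rot'_def rot''_def
  have orth: "orthogonal_matrix (rot c s)" "orthogonal_matrix (rot' c s)" "orthogonal_matrix (rot'' c s)"
    if "c\<^sup>2 + s\<^sup>2 = 1" for c s
    using that
    by (simp_all add: defs orthogonal_matrix vec_eq_iff matrix_matrix_mult_def mat_def transpose_def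
        forall_3 sum_3 power2_eq_square add.commute)
  have 1: "B $ 2 $ 1 - B $ 1 $ 2 = 0"
    using max[OF orth(1)]
    by (intro linear_le_quadratic_imp_zero[of _ "B $ 1 $ 1 + B $ 2 $ 2"])
       (simp add: defs inner_vec_def sum_3 mat_def algebra_simps)
  have 2: "B $ 3 $ 1 - B $ 1 $ 3 = 0"
    using max[OF orth(2)]
    by (intro linear_le_quadratic_imp_zero[of _ "B $ 1 $ 1 + B $ 3 $ 3"])
       (simp add: defs inner_vec_def sum_3 mat_def algebra_simps)
  have 3: "B $ 3 $ 2 - B $ 2 $ 3 = 0"
    using max[OF orth(3)]
    by (intro linear_le_quadratic_imp_zero[of _ "B $ 2 $ 2 + B $ 3 $ 3"])
       (simp add: defs inner_vec_def sum_3 mat_def algebra_simps)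
  show ?thesis
    using 1 2 3 by (simp add: vec_eq_iff transpose_def forall_3)
qed

text \<open>A singular value decomposition is read off a maximizer of
  \<open>\<langle>M, U W V\<^sup>T\<rangle>\<close> over pairs of orthogonal matrices, where \<open>W\<close> is diagonal with distinct
  positive entries: stationarity makes both \<open>B W\<close> and \<open>B\<^sup>T W\<close> symmetric for
  \<open>B = U\<^sup>T M V\<close>, hence \<open>B\<close> diagonal; sign changes and swaps order its entries.\<close>

lemma svd_exists: "\<exists>U s V. is_svd M U s V"
proof -
  let ?O = "{Q :: real^3^3. orthogonal_matrix Q}"
  define W :: "real^3^3" where "W = diag_mat (vector [3, 2, 1])"
  have WT: "transpose W = W" by (simp add: W_def)
  let ?f = "\<lambda>(U, V). inner M (U ** W ** transpose V)"
  have "compact (?O \<times> ?O)"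
    by (intro compact_Times compact_orthogonal_matrices)
  moreover have "(mat 1, mat 1) \<in> ?O \<times> ?O"
    by (simp add: orthogonal_matrix_id)
  then have "?O \<times> ?O \<noteq> {}" by blast
  moreover have "continuous_on (?O \<times> ?O) ?f"
    unfolding case_prod_beta by (intro continuous_intros)
  ultimately have "\<exists>x\<in>?O \<times> ?O. \<forall>y\<in>?O \<times> ?O. ?f y \<le> ?f x"
    by (rule continuous_attains_sup)
  then obtain U V where U: "orthogonal_matrix U" and V: "orthogonal_matrix V"
    and max: "\<And>U' V'. orthogonal_matrix U' \<Longrightarrow> orthogonal_matrix V' \<Longrightarrow>
      inner M (U' ** W ** transpose V') \<le> inner M (U ** W ** transpose V)"
    by (elim bexE SigmaE) simp
  define B where "B = transpose U ** M ** V"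
  have inner_B: "inner B (P ** W ** transpose Q) = inner M ((U ** P) ** W ** transpose (V ** Q))" for P Q
    by (simp add: B_def inner_matrix_mult_right[of "transpose U ** M"]
        inner_matrix_mult_left[of "transpose U" M] matrix_transpose_mul matrix_mul_assoc)
  \<comment> \<open>Orthogonal pairs form a group, so the maximum at \<open>(U, V)\<close> becomes a
    maximum for \<open>B\<close> at the pair of identities.\<close>
  have maxB: "inner B (P ** W ** transpose Q) \<le> inner B W"
    if "orthogonal_matrix P" "orthogonal_matrix Q" for P Q
  proof -
    have "inner B (mat 1 ** W ** transpose (mat 1)) = inner M (U ** W ** transpose V)"
      by (subst inner_B) simp
    moreover have "inner B (P ** W ** transpose Q) \<le> inner M (U ** W ** transpose V)"
      unfolding inner_B using that U V by (intro max orthogonal_matrix_mul)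
    ultimately show ?thesis by simp
  qed
  have sym1: "transpose (B ** W) = B ** W"
  proof (rule symmetric_if_trace_maximal)
    fix P :: "real^3^3" assume "orthogonal_matrix P"
    moreover have "inner P' (B ** W) = inner B (P' ** W ** transpose (mat 1))" for P'
      by (subst inner_commute) (simp add: inner_matrix_mult_right WT)
    ultimately show "inner P (B ** W) \<le> inner (mat 1) (B ** W)"
      using maxB[of P "mat 1"] by (simp add: orthogonal_matrix_id)
  qed
  have sym2: "transpose (transpose B ** W) = transpose B ** W"
  proof (rule symmetric_if_trace_maximal)
    fix P :: "real^3^3" assume "orthogonal_matrix P"
    moreover have "inner P' (transpose B ** W) = inner B (mat 1 ** W ** transpose P')" for P'
    proof -
      have "inner P' (transpose B ** W) = inner (transpose B) (P' ** W)"
        by (subst inner_commute) (simp add: inner_matrix_mult_right WT)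
      also have "\<dots> = inner B (transpose (P' ** W))"
        by (metis inner_transpose_transpose transpose_transpose)
      finally show ?thesis by (simp add: matrix_transpose_mul WT)
    qed
    ultimately show "inner P (transpose B ** W) \<le> inner (mat 1) (transpose B ** W)"
      using maxB[of "mat 1" P] by (simp add: orthogonal_matrix_id)
  qed
  \<comment> \<open>With weights \<open>w = (3, 2, 1)\<close> the two symmetries combine to
    \<open>(w_i^2 - w_j^2) * B_ij = 0\<close>, and the squares of the weights are distinct.\<close>
  have "B $ j $ i * vector [3, 2, 1] $ i = B $ i $ j * vector [3, 2, 1] $ j"
    "B $ i $ j * vector [3, 2, 1] $ i = B $ j $ i * vector [3, 2, 1] $ j" for i j :: 3
    using arg_cong[OF sym1, of "\<lambda>X. X $ i $ j"] arg_cong[OF sym2, of "\<lambda>X. X $ i $ j"]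
    by (simp_all add: W_def transpose_def matrix_mult_diag_mat_nth)
  from this[of 1 2] this[of 1 3] this[of 2 3]
  have off: "B $ 1 $ 2 = 0" "B $ 2 $ 1 = 0" "B $ 1 $ 3 = 0" "B $ 3 $ 1 = 0"
      "B $ 2 $ 3 = 0" "B $ 3 $ 2 = 0"
    by simp_all
  define s :: "real^3" where "s = (\<chi> i. B $ i $ i)"
  have B: "B = diag_mat s"
    by (simp add: vec_eq_iff forall_3 s_def off)
  define swap12 swap23 :: "real^3^3" where
    "swap12 = vector [vector [0, 1, 0], vector [1, 0, 0], vector [0, 0, 1]]" and
    "swap23 = vector [vector [1, 0, 0], vector [0, 0, 1], vector [0, 1, 0]]"
  note defs = swap12_def swap23_def
  have orth: "orthogonal_matrix swap12" "orthogonal_matrix swap23"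
    "orthogonal_matrix (diag_mat (vector [1, 1, -1]) :: real^3^3)"
    by (simp_all add: defs orthogonal_matrix vec_eq_iff matrix_matrix_mult_def mat_def
        transpose_def forall_3 sum_3)
  \<comment> \<open>Conjugation by a swap exchanges two weights, so for instance
    \<open>3 * s1 + 2 * s2 \<ge> 2 * s1 + 3 * s2\<close>. The sign change, applied on one side only,
    gives \<open>s3 \<ge> - s3\<close>.\<close>
  have "s $ 1 \<ge> s $ 2"
    using maxB[OF orth(1) orth(1)]
    by (simp add: B W_def defs inner_vec_def matrix_matrix_mult_def transpose_def sum_3)
  moreover have "s $ 2 \<ge> s $ 3"
    using maxB[OF orth(2) orth(2)]
    by (simp add: B W_def defs inner_vec_def matrix_matrix_mult_def transpose_def sum_3)
  moreover have "s $ 3 \<ge> 0"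
    using maxB[OF orth(3) orthogonal_matrix_id]
    by (simp add: B W_def mat_def inner_vec_def matrix_matrix_mult_def transpose_def sum_3)
  moreover have "M = U ** diag_mat s ** transpose V"
  proof -
    have "U ** diag_mat s ** transpose V = (U ** transpose U) ** M ** (V ** transpose V)"
      by (simp flip: B add: B_def matrix_mul_assoc)
    with U V show ?thesis by (simp add: orthogonal_matrix_def)
  qed
  ultimately show ?thesis
    using U V unfolding is_svd_def by blast
qed

section \<open>Measurability of the special orthogonal projection\<close>

text \<open>Eliminating \<open>s\<close> in favour of \<open>transpose U ** M ** V\<close> leaves
  only equations and weak inequalities between continuous functions of the matrices, which define a
  closed set.\<close>

lemma is_svdo_plus_iff:
  "is_svdo_plus M R \<longleftrightarrow>
    (\<exists>U V. orthogonal_matrix U \<and> orthogonal_matrix V \<and>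
      (let D = transpose U ** M ** V in
        D $ 1 $ 2 = 0 \<and> D $ 1 $ 3 = 0 \<and> D $ 2 $ 1 = 0 \<and> D $ 2 $ 3 = 0 \<and> D $ 3 $ 1 = 0 \<and> D $ 3 $ 2 = 0 \<and>
        D $ 2 $ 2 \<le> D $ 1 $ 1 \<and> D $ 3 $ 3 \<le> D $ 2 $ 2 \<and> 0 \<le> D $ 3 $ 3) \<and>
      R = U ** diag_mat (vector [1, 1, det (U ** transpose V)]) ** transpose V)"
  (is "_ \<longleftrightarrow> ?rhs")
proof
  assume "is_svdo_plus M R"
  then obtain U s V where svd: "is_svd M U s V"
    and R: "R = U ** diag_mat (vector [1, 1, det (U ** transpose V)]) ** transpose V"
    by (auto simp: is_svdo_plus_def)
  then have UV: "orthogonal_matrix U" "orthogonal_matrix V"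
    and M: "M = U ** diag_mat s ** transpose V"
    by (simp_all add: is_svd_def)
  have "transpose U ** M ** V = (transpose U ** U) ** diag_mat s ** (transpose V ** V)"
    by (simp add: M matrix_mul_assoc)
  then have "transpose U ** M ** V = diag_mat s"
    using UV by (simp add: orthogonal_matrix_def)
  with svd R UV show ?rhs
    by (intro exI[of _ U] exI[of _ V]) (simp add: is_svd_def Let_def)
next
  assume ?rhs
  then obtain U V D where UV: "orthogonal_matrix U" "orthogonal_matrix V"
    and D: "D = transpose U ** M ** V"
    and diag: "D $ 1 $ 2 = 0 \<and> D $ 1 $ 3 = 0 \<and> D $ 2 $ 1 = 0 \<and> D $ 2 $ 3 = 0 \<and> D $ 3 $ 1 = 0 \<and> D $ 3 $ 2 = 0"
    and ord: "D $ 2 $ 2 \<le> D $ 1 $ 1 \<and> D $ 3 $ 3 \<le> D $ 2 $ 2 \<and> 0 \<le> D $ 3 $ 3"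
    and R: "R = U ** diag_mat (vector [1, 1, det (U ** transpose V)]) ** transpose V"
    by (auto simp: Let_def)
  have D': "D = diag_mat (\<chi> i. D $ i $ i)"
    using diag by (simp add: vec_eq_iff forall_3)
  have "U ** D ** transpose V = (U ** transpose U) ** M ** (V ** transpose V)"
    by (simp add: D matrix_mul_assoc)
  then have "M = U ** diag_mat (\<chi> i. D $ i $ i) ** transpose V"
    using UV by (simp add: orthogonal_matrix_def flip: D')
  with UV ord have "is_svd M U (\<chi> i. D $ i $ i) V"
    by (simp add: is_svd_def)
  with R show "is_svdo_plus M R"
    by (auto simp: is_svdo_plus_def)
qed

text \<open>The graph is the projection of a closed set along the compact factor of orthogonal pairs
  \<open>(U, V)\<close>.\<close>

lemma closed_is_svdo_plus: "closed {(R, M). is_svdo_plus M R}"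
proof -
  let ?O = "{Q :: real^3^3. orthogonal_matrix Q}"
  \<comment> \<open>Points are \<open>p = ((U, V), (R, M))\<close>: the compact factor to be
    projected away comes first.\<close>
  let ?D = "\<lambda>p :: ((real^3^3) \<times> (real^3^3)) \<times> ((real^3^3) \<times> (real^3^3)).
    transpose (fst (fst p)) ** snd (snd p) ** snd (fst p)"
  let ?d = "\<lambda>p :: ((real^3^3) \<times> (real^3^3)) \<times> ((real^3^3) \<times> (real^3^3)).
    vector [1, 1, det (fst (fst p) ** transpose (snd (fst p)))] :: real^3"
  let ?T = "{p. ?D p $ 1 $ 2 = 0 \<and> ?D p $ 1 $ 3 = 0 \<and> ?D p $ 2 $ 1 = 0 \<and> ?D p $ 2 $ 3 = 0 \<and>
    ?D p $ 3 $ 1 = 0 \<and> ?D p $ 3 $ 2 = 0 \<and>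
    ?D p $ 2 $ 2 \<le> ?D p $ 1 $ 1 \<and> ?D p $ 3 $ 3 \<le> ?D p $ 2 $ 2 \<and> 0 \<le> ?D p $ 3 $ 3 \<and>
    fst (snd p) = fst (fst p) ** diag_mat (?d p) ** transpose (snd (fst p))}"
  \<comment> \<open>Written entrywise, so that continuity in \<open>p\<close> reduces to that of the
    single determinant entry.\<close>
  have diag: "diag_mat (vector [1, 1, x] :: real^3)
      = (\<chi> i j. if i = j then (if i = 3 then x else 1) else 0)" for x
    by (simp add: vec_eq_iff forall_3)
  have det: "continuous_on UNIV (\<lambda>p :: ((real^3^3) \<times> (real^3^3)) \<times> ((real^3^3) \<times> (real^3^3)).
      det (fst (fst p) ** transpose (snd (fst p))))"
    by (intro continuous_intros)
  have entry: "continuous_on UNIV (\<lambda>p :: ((real^3^3) \<times> (real^3^3)) \<times> ((real^3^3) \<times> (real^3^3)).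
      if i = j then if i = 3 then det (fst (fst p) ** transpose (snd (fst p))) else 1 else 0)"
    for i j :: 3
    using det by (cases "i = j"; cases "i = 3") simp_all
  have "continuous_on UNIV (\<lambda>p. diag_mat (?d p))"
    unfolding diag by (intro continuous_on_vec_lambda entry)
  then have "closed ?T"
    by (intro closed_Collect_conj closed_Collect_eq closed_Collect_le continuous_intros)
  then have "closed {y. \<exists>x. x \<in> ?O \<times> ?O \<and> (x, y) \<in> ?T}"
    by (intro closed_compact_projection compact_Times compact_orthogonal_matrices)
  also have "{y. \<exists>x. x \<in> ?O \<times> ?O \<and> (x, y) \<in> ?T} = {(R, M). is_svdo_plus M R}"
    by (simp add: set_eq_iff is_svdo_plus_iff Let_def)
  finally show ?thesis .
qed

text \<open>Since all values lie in a compact set, projecting closed conditions on the values yields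
  closed sets of arguments. Both the uniqueness set and the preimages of closed sets are Boolean
  combinations of countably many of these.\<close>

lemma borel_measurable_unique_selection:
  fixes P :: "'a::euclidean_space \<Rightarrow> 'b::euclidean_space \<Rightarrow> bool"
  assumes clo: "closed {(y, x). P x y}" and K: "compact K" "\<And>x y. P x y \<Longrightarrow> y \<in> K"
  shows "(\<lambda>x. if \<exists>!y. P x y then THE y. P x y else c) \<in> borel_measurable borel"
proof -
  define f where "f x = (if \<exists>!y. P x y then THE y. P x y else c)" for x
  have hit: "{x. \<exists>y\<in>C. P x y} \<in> sets borel" if "closed C" for C
  proof -
    have "closed ({(y, x). P x y} \<inter> C \<times> UNIV)"
      using clo that by (intro closed_Int closed_Times) auto
    from closed_compact_projection[OF K(1) this]
    have "closed {x. \<exists>y. y \<in> K \<and> (y, x) \<in> {(y, x). P x y} \<inter> C \<times> UNIV}" .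
    also have "{x. \<exists>y. y \<in> K \<and> (y, x) \<in> {(y, x). P x y} \<inter> C \<times> UNIV} = {x. \<exists>y\<in>C. P x y}"
      using K(2) by auto
    finally show ?thesis by simp
  qed
  have spread: "{x. \<exists>y y'. P x y \<and> P x y' \<and> dist y y' \<ge> e} \<in> sets borel" for e
  proof -
    let ?G = "{(y, x). P x y}"
    let ?T = "(\<lambda>p. (fst (fst p), snd p)) -` ?G \<inter> (\<lambda>p. (snd (fst p), snd p)) -` ?G
      \<inter> {p. e \<le> dist (fst (fst p)) (snd (fst p))}"
    have "closed ?T"
      by (intro closed_Int closed_vimage clo closed_Collect_le continuous_intros)
    from closed_compact_projection[OF compact_Times[OF K(1) K(1)] this]
    have "closed {x. \<exists>z. z \<in> K \<times> K \<and> (z, x) \<in> ?T}" .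
    also have "{x. \<exists>z. z \<in> K \<times> K \<and> (z, x) \<in> ?T} = {x. \<exists>y y'. P x y \<and> P x y' \<and> dist y y' \<ge> e}"
      using K(2) by auto
    finally show ?thesis by simp
  qed
  \<comment> \<open>Non-uniqueness means that two values are at distance at least
    \<open>1 / (n + 1)\<close> for some \<open>n\<close>, a countable union of the closed sets from
    \<open>spread\<close>.\<close>
  have "{x. \<exists>!y. P x y} = {x. \<exists>y\<in>UNIV. P x y}
      - (\<Union>n. {x. \<exists>y y'. P x y \<and> P x y' \<and> dist y y' \<ge> inverse (real (Suc n))})"
  proof -
    have "y \<noteq> y' \<longleftrightarrow> (\<exists>n. inverse (real (Suc n)) \<le> dist y y')" for y y' :: 'b
    proof
      assume "y \<noteq> y'"
      then show "\<exists>n. inverse (real (Suc n)) \<le> dist y y'"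
        using reals_Archimedean[of "dist y y'"] by (auto intro: less_imp_le)
    next
      assume "\<exists>n. inverse (real (Suc n)) \<le> dist y y'"
      moreover have "0 < inverse (real (Suc n))" for n by simp
      ultimately show "y \<noteq> y'" by (metis dist_self not_le)
    qed
    then have eq: "(\<exists>n y y'. P x y \<and> P x y' \<and> inverse (real (Suc n)) \<le> dist y y')
        \<longleftrightarrow> (\<exists>y y'. P x y \<and> P x y' \<and> y \<noteq> y')" for x
      by blast
    have "(\<exists>!y. P x y) \<longleftrightarrow> (\<exists>y. P x y) \<and>
        \<not> (\<exists>n y y'. P x y \<and> P x y' \<and> inverse (real (Suc n)) \<le> dist y y')" for x
      unfolding eq by auto
    then show ?thesis by (intro set_eqI) simp
  qed
  then have E: "{x. \<exists>!y. P x y} \<in> sets borel"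
    using hit[of UNIV] spread by auto
  have closed_pre: "f -` C \<in> sets borel" if "closed C" for C
  proof -
    \<comment> \<open>On the uniqueness set, \<open>f x\<close> lies in \<open>C\<close> exactly
      when some value does; elsewhere only the constant \<open>c\<close> matters.\<close>
    have "f -` C = ({x. \<exists>!y. P x y} \<inter> {x. \<exists>y\<in>C. P x y}) \<union> (if c \<in> C then - {x. \<exists>!y. P x y} else {})"
    proof (rule set_eqI)
      fix x
      show "x \<in> f -` C \<longleftrightarrow>
        x \<in> ({x. \<exists>!y. P x y} \<inter> {x. \<exists>y\<in>C. P x y}) \<union> (if c \<in> C then - {x. \<exists>!y. P x y} else {})"
      proof (cases "\<exists>!y. P x y")
        case True
        then have "P x (f x)" by (simp add: f_def theI')
        with True show ?thesis by auto
      qed (simp add: f_def)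
    qed
    then show ?thesis using E hit[OF that] by auto
  qed
  have "f \<in> borel_measurable borel"
  proof (rule borel_measurableI)
    fix S :: "'b set" assume "open S"
    then have "- (f -` (- S)) \<in> sets borel"
      by (intro borel_comp closed_pre) (simp add: closed_Compl)
    then show "f -` S \<inter> space borel \<in> sets borel" by (simp add: vimage_Compl)
  qed
  then show ?thesis by (simp add: f_def[abs_def])
qed

lemma borel_measurable_svdo_plus: "svdo_plus \<in> borel_measurable borel"
  unfolding svdo_plus_def[abs_def]
  by (rule borel_measurable_unique_selection[OF closed_is_svdo_plus compact_orthogonal_matrices])
    (simp add: is_svdo_plus_orthogonal)

section \<open>Perturbation of the special orthogonal projection\<close>

text \<open>A positive determinant forces \<open>det (U ** transpose V) = 1\<close> and excludes
  zero singular values. Hence \<open>R = U ** transpose V\<close>, and the result is the polar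
  decomposition of \<open>M\<close> with a positive definite factor.\<close>

lemma is_svdo_plus_det_pos:
  assumes "is_svdo_plus M R" and "det M > 0"
  obtains V s where "orthogonal_matrix V" "\<And>i. s $ i > 0"
    "M = R ** (V ** diag_mat s ** transpose V)"
proof -
  obtain U s V where svd: "is_svd M U s V"
    and R: "R = U ** diag_mat (vector [1, 1, det (U ** transpose V)]) ** transpose V"
    using assms(1) by (auto simp: is_svdo_plus_def)
  then have UV: "orthogonal_matrix U" "orthogonal_matrix V"
    and s: "s $ 1 \<ge> s $ 2" "s $ 2 \<ge> s $ 3" "s $ 3 \<ge> 0"
    and M: "M = U ** diag_mat s ** transpose V"
    by (simp_all add: is_svd_def)
  have "det M = det (U ** transpose V) * det (diag_mat s)"
    by (simp add: M det_mul)
  moreover have "det (diag_mat s) \<ge> 0"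
    using s by (simp add: det_diag_mat3)
  moreover have "det (U ** transpose V) = 1 \<or> det (U ** transpose V) = -1"
    using UV by (intro det_orthogonal_matrix orthogonal_matrix_mul) simp_all
  ultimately have det1: "det (U ** transpose V) = 1" and "det (diag_mat s) > 0"
    using assms(2) by auto
  then have "s $ 3 \<noteq> 0" by (auto simp: det_diag_mat3)
  with s have pos: "s $ i > 0" for i
    using exhaust_3[of i] by auto
  have "diag_mat (vector [1, 1, 1]) = (mat 1 :: real^3^3)"
    by (simp add: vec_eq_iff forall_3 mat_def)
  then have "R = U ** transpose V"
    by (simp add: R det1)
  then have "R ** (V ** diag_mat s ** transpose V) = U ** (transpose V ** V) ** diag_mat s ** transpose V"
    by (simp add: matrix_mul_assoc)
  then have "M = R ** (V ** diag_mat s ** transpose V)"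
    using UV by (simp add: orthogonal_matrix M)
  with UV(2) pos that show ?thesis by blast
qed

text \<open>The columns are unit vectors, for which \<open>1 - inner a b\<close> is half the squared
  distance. The optimality gap thus becomes an explicit weighted sum of squares.\<close>

lemma inner_diff_orthogonal_diag:
  fixes A B :: "real^'n^'n"
  assumes "orthogonal_matrix A" "orthogonal_matrix B"
  shows "inner (B - A) (B ** diag_mat s) = (\<Sum>j\<in>UNIV. s $ j * (norm (column j A - column j B))\<^sup>2) / 2"
proof -
  have inner_cols: "inner C (B ** diag_mat s) = (\<Sum>j\<in>UNIV. s $ j * inner (column j C) (column j B))"
    for C :: "real^'n^'n"
    unfolding inner_vec_def column_def
    by (simp add: matrix_mult_diag_mat_nth sum_distrib_left mult_ac) (rule sum.swap)
  have norm1: "norm (column j A) = 1" "norm (column j B) = 1" for j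
    using assms by (simp_all add: orthogonal_matrix_orthonormal_columns)
  have dist: "1 - inner (column j A) (column j B) = (norm (column j A - column j B))\<^sup>2 / 2" for j
    using norm1[of j]
    by (simp add: power2_norm_eq_inner inner_diff norm_eq_1 inner_commute)
  have "inner (B - A) (B ** diag_mat s)
      = (\<Sum>j\<in>UNIV. s $ j * (inner (column j B) (column j B) - inner (column j A) (column j B)))"
    unfolding inner_diff_left unfolding inner_cols
    by (simp add: right_diff_distrib sum_subtractf)
  also have "\<dots> = (\<Sum>j\<in>UNIV. s $ j * ((norm (column j A - column j B))\<^sup>2 / 2))"
    using norm1(2) by (simp add: norm_eq_1 flip: dist)
  finally show ?thesis by (simp add: sum_divide_distrib)
qed

lemma inner_diff_polar:
  fixes R R' :: "real^'n^'n"
  assumes "orthogonal_matrix R" "orthogonal_matrix R'" "orthogonal_matrix V"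
  shows "inner (R - R') (R ** (V ** diag_mat s ** transpose V))
    = (\<Sum>j\<in>UNIV. s $ j * (norm (column j (R' ** V) - column j (R ** V)))\<^sup>2) / 2"
proof -
  have "inner (R - R') (R ** (V ** diag_mat s ** transpose V))
      = inner (R ** V - R' ** V) (R ** V ** diag_mat s)"
    by (simp add: inner_matrix_mult_right matrix_mul_assoc flip: matrix_diff_rdistrib)
  then show ?thesis
    using assms by (simp add: inner_diff_orthogonal_diag orthogonal_matrix_mul)
qed

text \<open>In the gap formula all weights are positive singular values, so the gap is nonnegative
  and vanishes only if all columns agree. The competitor may be any orthogonal matrix, not just a
  rotation.\<close>

lemma is_svdo_plus_optimal:
  assumes "is_svdo_plus M R" "det M > 0" "orthogonal_matrix R'"
  shows "inner (R - R') M \<ge> 0" and "inner (R - R') M = 0 \<Longrightarrow> R' = R"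
proof -
  obtain V s where V: "orthogonal_matrix V" and s: "\<And>i. s $ i > 0"
    and M: "M = R ** (V ** diag_mat s ** transpose V)"
    using is_svdo_plus_det_pos[OF assms(1,2)] by blast
  have eq: "inner (R - R') M = (\<Sum>j\<in>UNIV. s $ j * (norm (column j (R' ** V) - column j (R ** V)))\<^sup>2) / 2"
    unfolding M using is_svdo_plus_orthogonal[OF assms(1)] assms(3) V by (rule inner_diff_polar)
  have nonneg: "s $ j * (norm (column j (R' ** V) - column j (R ** V)))\<^sup>2 \<ge> 0" for j
    using s[of j] by (simp add: less_imp_le)
  show "inner (R - R') M \<ge> 0"
    unfolding eq using nonneg by (simp add: sum_nonneg)
  assume "inner (R - R') M = 0"
  then have zero: "s $ j * (norm (column j (R' ** V) - column j (R ** V)))\<^sup>2 = 0" for j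
    unfolding eq using nonneg by (simp add: sum_nonneg_eq_0_iff)
  have "column j (R' ** V) = column j (R ** V)" for j
    using zero[of j] s[of j] by auto
  then have "R' ** V = R ** V"
    by (simp add: column_def vec_eq_iff)
  then have "R' ** (V ** transpose V) = R ** (V ** transpose V)"
    by (simp add: matrix_mul_assoc)
  then show "R' = R"
    using V by (simp add: orthogonal_matrix_def)
qed

text \<open>Two candidates are each optimal against the other, and the two gaps are negatives of
  each other; so both vanish and strictness gives uniqueness.\<close>

lemma is_svdo_plus_svdo_plus:
  assumes "det M > 0"
  shows "is_svdo_plus M (svdo_plus M)"
proof -
  have "\<exists>!R. is_svdo_plus M R"
  proof (rule ex_ex1I)
    show "\<exists>R. is_svdo_plus M R"
      using svd_exists[of M] by (auto simp: is_svdo_plus_def)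
    fix R R' assume RR: "is_svdo_plus M R" "is_svdo_plus M R'"
    note orth = RR[THEN is_svdo_plus_orthogonal]
    have "inner (R' - R) M = - inner (R - R') M"
      by (simp add: inner_diff_left)
    then have "inner (R' - R) M = 0"
      using is_svdo_plus_optimal(1)[OF RR(1) assms orth(2)]
        is_svdo_plus_optimal(1)[OF RR(2) assms orth(1)] by linarith
    then show "R = R'"
      by (rule is_svdo_plus_optimal(2)[OF RR(2) assms orth(1)])
  qed
  then show ?thesis by (simp add: svdo_plus_def theI')
qed

text \<open>Both matrices have the same norm, so the squared distance equals
  \<open>-2 * inner (?R - T) T\<close>. Adding twice the nonnegative optimality gap replaces
  \<open>- T\<close> by \<open>M - T\<close>, and Cauchy-Schwarz finishes.\<close>

lemma norm_svdo_plus_diff_le: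
  assumes "det M > 0" and T: "orthogonal_matrix T"
  shows "norm (svdo_plus M - T) \<le> 2 * norm (M - T)"
proof -
  let ?R = "svdo_plus M"
  have "inner ?R ?R = 3" "inner T T = 3"
    using norm_orthogonal_matrix[OF T] norm_orthogonal_matrix[OF svdo_plus_orthogonal[of M]]
    by (simp_all flip: power2_norm_eq_inner)
  then have "(norm (?R - T))\<^sup>2 = - 2 * inner (?R - T) T"
    by (simp add: power2_norm_eq_inner inner_diff inner_commute)
  also have "\<dots> \<le> 2 * inner (?R - T) (M - T)"
    using is_svdo_plus_optimal(1)[OF is_svdo_plus_svdo_plus[OF assms(1)] assms]
    by (simp add: inner_diff_right)
  also have "\<dots> \<le> 2 * (norm (?R - T) * norm (M - T))"
    using norm_cauchy_schwarz[of "?R - T" "M - T"] by simp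
  finally have "norm (?R - T) * norm (?R - T) \<le> norm (?R - T) * (2 * norm (M - T))"
    by (simp add: power2_eq_square)
  then show ?thesis
    by (cases "norm (?R - T) = 0") (simp_all add: mult_le_cancel_left)
qed

text \<open>Orthogonality of \<open>Q\<close> and symmetry of \<open>Q\<^sup>T A\<close> together determine \<open>Q - 1\<close> in terms of
  the skew part of \<open>A - 1\<close>, up to quadratic terms.\<close>

lemma polar_factor_expansion:
  fixes Q A :: "real^'n^'n"
  assumes Q: "orthogonal_matrix Q" and sym: "transpose (transpose Q ** A) = transpose Q ** A"
  defines "X \<equiv> Q - mat 1" and "E \<equiv> A - mat 1"
  shows "2 *\<^sub>R X = (E - transpose E) + transpose X ** E - transpose E ** X - transpose X ** X"
proof -
  have QX: "transpose Q = mat 1 + transpose X"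
    by (simp add: X_def transpose_diff)
  have AE: "A = mat 1 + E" and QX': "Q = mat 1 + X"
    by (simp_all add: X_def E_def)
  have AT: "transpose A = mat 1 + transpose E"
    by (simp add: E_def transpose_diff)
  have "transpose A ** Q = transpose Q ** A"
    using sym by (simp add: matrix_transpose_mul)
  then have 1: "mat 1 + transpose E + (X + transpose E ** X) = mat 1 + E + (transpose X + transpose X ** E)"
    unfolding QX AT by (simp add: AE QX' matrix_add_ldistrib matrix_add_rdistrib)
  have 2: "mat 1 + X + (transpose X + transpose X ** X) = mat 1"
    using Q unfolding orthogonal_matrix QX by (simp add: QX' matrix_add_ldistrib matrix_add_rdistrib add_ac)
  \<comment> \<open>Adding the symmetry equation \<open>1\<close> to the orthogonality equation
    \<open>2\<close> cancels the linear term \<open>transpose X\<close>.\<close>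
  have "2 *\<^sub>R X - ((E - transpose E) + transpose X ** E - transpose E ** X - transpose X ** X)
      = ((mat 1 + transpose E + (X + transpose E ** X)) - (mat 1 + E + (transpose X + transpose X ** E)))
        + ((mat 1 + X + (transpose X + transpose X ** X)) - mat 1)"
    by (simp add: scaleR_2 algebra_simps)
  also have "\<dots> = 0"
    unfolding 1 2 by simp
  finally show ?thesis by simp
qed

text \<open>The orthogonal projection onto the skew-symmetric matrices, the tangent space of the
  rotation group at the identity.\<close>

definition skew_part :: "real^'n^'n \<Rightarrow> real^'n^'n" where
  "skew_part A = (1/2) *\<^sub>R (A - transpose A)"

lemma norm_skew_part_le: "norm (skew_part A) \<le> norm A"
  using norm_triangle_ineq4[of A "transpose A"] by (simp add: skew_part_def)

lemma skew_part_scaleR: "skew_part (c *\<^sub>R A) = c *\<^sub>R skew_part A"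
  by (simp add: skew_part_def transpose_def vec_eq_iff algebra_simps)

text \<open>In this form the expectation needs only second moments of the entries.\<close>

lemma norm_skew_part_sq: "(norm (skew_part A))\<^sup>2 = ((norm A)\<^sup>2 - inner A (transpose A)) / 2"
proof -
  have "(norm (skew_part A))\<^sup>2 = (norm (A - transpose A))\<^sup>2 / 4"
    by (simp add: skew_part_def power_divide)
  also have "(norm (A - transpose A))\<^sup>2 = 2 * ((norm A)\<^sup>2 - inner A (transpose A))"
    by (simp add: power2_norm_eq_inner inner_diff inner_commute inner_transpose_transpose)
  finally show ?thesis by simp
qed

text \<open>Multiplication by \<open>transpose T\<close> preserves norms and moves the base point to
  the identity, where the polar factor expansion applies to \<open>Q\<close> and
  \<open>A\<close>.\<close>

lemma svdo_plus_expansion_det_pos: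
  assumes T: "orthogonal_matrix T" and det: "det (T + F) > 0"
  shows "\<bar>(norm (svdo_plus (T + F) - T))\<^sup>2 - (norm (skew_part (transpose T ** F)))\<^sup>2\<bar> \<le> 12 * norm F ^ 3"
proof -
  let ?R = "svdo_plus (T + F)"
  define Q where "Q = transpose T ** ?R"
  define A where "A = transpose T ** (T + F)"
  define X where "X = Q - mat 1"
  define E where "E = transpose T ** F"
  have TT: "orthogonal_matrix (transpose T)" using T by simp
  have Qo: "orthogonal_matrix Q"
    unfolding Q_def using TT svdo_plus_orthogonal by (rule orthogonal_matrix_mul)
  have A: "A - mat 1 = E"
    using T by (simp add: A_def E_def matrix_add_ldistrib orthogonal_matrix)
  have X: "X = transpose T ** (?R - T)"
    using T by (simp add: X_def Q_def matrix_diff_ldistrib orthogonal_matrix)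
  have norm_E: "norm E = norm F" and norm_X: "norm X = norm (?R - T)"
    unfolding E_def X using norm_orthogonal_mult[OF TT] by auto
  have bound_X: "norm X \<le> 2 * norm E"
    using norm_svdo_plus_diff_le[OF det T] by (simp add: norm_E norm_X)
  obtain V :: "real^3^3" and s :: "real^3" where polar: "T + F = ?R ** (V ** diag_mat s ** transpose V)"
    using is_svdo_plus_det_pos[OF is_svdo_plus_svdo_plus[OF det] det] by blast
  have "transpose ?R ** (T + F) = (transpose ?R ** ?R) ** (V ** diag_mat s ** transpose V)"
    using arg_cong[OF polar, of "(**) (transpose ?R)"] by (simp add: matrix_mul_assoc)
  then have "transpose ?R ** (T + F) = V ** diag_mat s ** transpose V"
    using svdo_plus_orthogonal[of "T + F"] by (simp add: orthogonal_matrix_def)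
  moreover have "transpose Q ** A = transpose ?R ** (T + F)"
  proof -
    have "transpose Q ** A = transpose ?R ** (T ** transpose T) ** (T + F)"
      by (simp add: Q_def A_def matrix_transpose_mul matrix_mul_assoc)
    then show ?thesis using T by (simp add: orthogonal_matrix_def)
  qed
  ultimately have "transpose (transpose Q ** A) = transpose Q ** A"
    by (simp add: matrix_transpose_mul matrix_mul_assoc)
  from polar_factor_expansion[OF Qo this]
  have "2 *\<^sub>R X = (E - transpose E) + transpose X ** E - transpose E ** X - transpose X ** X"
    by (simp add: X_def A)
  then have eq: "2 *\<^sub>R (X - skew_part E) = transpose X ** E - transpose E ** X - transpose X ** X"
    by (simp add: skew_part_def scaleR_diff_right)
  have "2 * norm (X - skew_part E) = norm (2 *\<^sub>R (X - skew_part E))"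
    by simp
  also have "\<dots> = norm (transpose X ** E - transpose E ** X - transpose X ** X)"
    by (simp only: eq)
  also have "\<dots> \<le> norm (transpose X ** E) + norm (transpose E ** X) + norm (transpose X ** X)"
    using norm_triangle_ineq4[of "transpose X ** E - transpose E ** X" "transpose X ** X"]
      norm_triangle_ineq4[of "transpose X ** E" "transpose E ** X"] by linarith
  also have "\<dots> \<le> norm X * norm E + norm E * norm X + norm X * norm X"
    using norm_matrix_mult_le[of "transpose X" E] norm_matrix_mult_le[of "transpose E" X]
      norm_matrix_mult_le[of "transpose X" X] unfolding norm_transpose by linarith
  \<comment> \<open>The three terms contribute \<open>2 + 2 + 4 = 8\<close> times
    \<open>(norm E)^2\<close>; halving gives the constant 4.\<close>
  also have "\<dots> \<le> (2 * norm E) * norm E + norm E * (2 * norm E) + (2 * norm E) * (2 * norm E)"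
    using bound_X by (intro add_mono mult_mono) auto
  finally have diff: "norm (X - skew_part E) \<le> 4 * (norm E)\<^sup>2"
    by (simp add: power2_eq_square)
  have sum: "norm (X + skew_part E) \<le> 3 * norm E"
    using norm_triangle_ineq[of X "skew_part E"] bound_X norm_skew_part_le[of E] by linarith
  \<comment> \<open>A difference of squares factors as an inner product; the bounds
    \<open>4 * (norm E)^2\<close> and \<open>3 * norm E\<close> multiply to the constant 12.\<close>
  have "\<bar>(norm X)\<^sup>2 - (norm (skew_part E))\<^sup>2\<bar> = \<bar>inner (X - skew_part E) (X + skew_part E)\<bar>"
    by (simp add: power2_norm_eq_inner inner_diff inner_add inner_commute)
  also have "\<dots> \<le> norm (X - skew_part E) * norm (X + skew_part E)"
    by (rule Cauchy_Schwarz_ineq2)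
  also have "\<dots> \<le> (4 * (norm E)\<^sup>2) * (3 * norm E)"
    using diff sum by (intro mult_mono) auto
  finally show ?thesis
    by (simp add: norm_X norm_E power2_eq_square power3_eq_cube flip: E_def)
qed

text \<open>Gaussian noise is unbounded, so integration needs one constant valid for every
  \<open>F\<close>, including those where the determinant is not positive.\<close>

lemma svdo_plus_expansion:
  assumes "rotation_matrix T"
  obtains C where "C \<ge> 0"
    "\<And>F. \<bar>(norm (svdo_plus (T + F) - T))\<^sup>2 - (norm (skew_part (transpose T ** F)))\<^sup>2\<bar> \<le> C * norm F ^ 3"
proof -
  have T: "orthogonal_matrix T" and "det T = 1"
    using assms by (simp_all add: rotation_matrix_def)
  have "open {M :: real^3^3. 0 < det M}"
    by (intro open_Collect_less continuous_intros)
  then obtain c where c: "c > 0" and ball: "ball T c \<subseteq> {M. 0 < det M}"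
    using \<open>det T = 1\<close> by (metis mem_Collect_eq open_contains_ball zero_less_one)
  \<comment> \<open>The first entry serves \<open>norm F < c\<close>. Otherwise the squared error is
    at most \<open>(2 * sqrt 3)^2 = 12\<close>, hence at most \<open>12 / c^3 * norm F ^ 3\<close>,
    and \<open>(norm F)^2\<close> is at most \<open>1 / c * norm F ^ 3\<close>.\<close>
  define C where "C = max 12 (12 / c ^ 3 + 1 / c)"
  have "\<bar>(norm (svdo_plus (T + F) - T))\<^sup>2 - (norm (skew_part (transpose T ** F)))\<^sup>2\<bar> \<le> C * norm F ^ 3"
    for F
  proof (cases "norm F < c")
    case True
    then have "T + F \<in> ball T c" by (simp add: dist_norm)
    with ball have "det (T + F) > 0" by blast
    from svdo_plus_expansion_det_pos[OF T this]
    show ?thesis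
      by (rule order_trans) (simp add: C_def mult_right_mono)
  next
    case False
    then have F: "c \<le> norm F" by simp
    have "norm (svdo_plus (T + F) - T) \<le> 2 * sqrt 3"
      using norm_triangle_ineq4[of "svdo_plus (T + F)" T]
      by (simp add: norm_orthogonal_matrix T svdo_plus_orthogonal)
    then have "(norm (svdo_plus (T + F) - T))\<^sup>2 \<le> (2 * sqrt 3)\<^sup>2"
      by (intro power_mono) auto
    then have 1: "(norm (svdo_plus (T + F) - T))\<^sup>2 \<le> 12"
      by (simp add: power_mult_distrib)
    have "norm (skew_part (transpose T ** F)) \<le> norm F"
      using norm_skew_part_le[of "transpose T ** F"] T by (simp add: norm_orthogonal_mult)
    then have 2: "(norm (skew_part (transpose T ** F)))\<^sup>2 \<le> (norm F)\<^sup>2"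
      by (intro power_mono) auto
    have "12 \<le> 12 / c ^ 3 * norm F ^ 3"
      using power_mono[OF F, of 3] c by (simp add: field_simps)
    moreover have "(norm F)\<^sup>2 \<le> 1 / c * norm F ^ 3"
      using F c by (simp add: field_simps power2_eq_square power3_eq_cube mult_right_mono)
    ultimately have "12 + (norm F)\<^sup>2 \<le> (12 / c ^ 3 + 1 / c) * norm F ^ 3"
      by (simp add: distrib_right)
    also have "\<dots> \<le> C * norm F ^ 3"
      by (intro mult_right_mono) (simp_all add: C_def)
    finally show ?thesis
      using 1 2 zero_le_power2[of "norm (svdo_plus (T + F) - T)"]
        zero_le_power2[of "norm (skew_part (transpose T ** F))"] by linarith
  qed
  moreover have "C \<ge> 0" by (simp add: C_def)
  ultimately show ?thesis using that by blast
qed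

section \<open>Gaussian noise\<close>

lemma borel_measurable_matrix:
  fixes f :: "'a \<Rightarrow> real^'n^'m"
  assumes "\<And>i j. (\<lambda>\<omega>. f \<omega> $ i $ j) \<in> borel_measurable M"
  shows "f \<in> borel_measurable M"
proof (rule borel_measurable_euclidean_space[THEN iffD2], intro ballI)
  fix b :: "real^'n^'m" assume "b \<in> Basis"
  then obtain i j where "b = axis i (axis j 1)"
    by (auto simp: Basis_vec_def)
  then show "(\<lambda>\<omega>. f \<omega> \<bullet> b) \<in> borel_measurable M"
    using assms by (simp add: inner_axis)
qed

text \<open>Unit variance on the diagonal; off it, independence factors the expectation into zero
  means. The indicator acts as a Kronecker delta in the later sums.\<close>

lemma (in prob_space) indep_std_normal_product:
  fixes X :: "'i \<Rightarrow> 'a \<Rightarrow> real"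
  assumes indep: "indep_vars (\<lambda>_. borel) X I"
    and normal: "\<And>i. i \<in> I \<Longrightarrow> distributed M lborel (X i) std_normal_density"
    and ij: "i \<in> I" "j \<in> I"
  shows "has_bochner_integral M (\<lambda>\<omega>. X i \<omega> * X j \<omega>) (of_bool (i = j))"
proof (cases "i = j")
  case True
  have "integrable M (\<lambda>\<omega>. (X i \<omega>)\<^sup>2)"
    using distributed_integrable[OF normal[OF ij(1)], of "\<lambda>x. x\<^sup>2"] integrable_std_normal_moment[of 2]
    by simp
  moreover have "expectation (\<lambda>\<omega>. (X i \<omega>)\<^sup>2) = 1"
    using distributed_integral[OF normal[OF ij(1)], of "\<lambda>x. x\<^sup>2"]
      integral_std_normal_moment_even[of 1]
    by simp
  ultimately show ?thesis
    using True by (simp add: has_bochner_integral_iff power2_eq_square)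
next
  case False
  have sub: "indep_vars (\<lambda>_. borel) X {i, j}"
    using ij by (intro indep_vars_subset[OF indep]) auto
  have int: "integrable M (X k)" if "k \<in> {i, j}" for k
    using that ij normal distributed_integrable[OF normal, of k "\<lambda>x. x"] integrable_std_normal_moment[of 1]
    by auto
  have zero: "expectation (X i) = 0"
    by (rule standard_normal_distributed_expectation[OF normal[OF ij(1)]])
  have "expectation (\<lambda>\<omega>. \<Prod>k\<in>{i, j}. X k \<omega>) = (\<Prod>k\<in>{i, j}. expectation (X k))"
    using sub int by (intro indep_vars_lebesgue_integral) auto
  moreover have "integrable M (\<lambda>\<omega>. \<Prod>k\<in>{i, j}. X k \<omega>)"
    using sub int by (intro indep_vars_integrable) auto
  ultimately show ?thesis
    using False zero by (simp add: has_bochner_integral_iff)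
qed

text \<open>Cauchy-Schwarz against the constant 1 over all index pairs, applied to the squared
  entries.\<close>

lemma norm_matrix_power4_le:
  fixes A :: "real^'n^'m"
  shows "norm A ^ 4 \<le> real (CARD('m) * CARD('n)) * (\<Sum>i\<in>UNIV. \<Sum>j\<in>UNIV. (A $ i $ j) ^ 4)"
proof -
  have pairs: "(\<Sum>i\<in>UNIV. \<Sum>j\<in>UNIV. f (A $ i $ j)) = (\<Sum>p\<in>UNIV. f (A $ fst p $ snd p))"
    for f :: "real \<Rightarrow> real"
    by (simp add: sum.cartesian_product case_prod_beta)
  have sq: "(norm A)\<^sup>2 = (\<Sum>p\<in>UNIV. (A $ fst p $ snd p)\<^sup>2)"
    using pairs[of "\<lambda>x. x\<^sup>2"] by (simp add: norm_matrix_eq_Frobenius sum_nonneg)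
  have "norm A ^ 4 = (\<Sum>p\<in>UNIV. 1 * (A $ fst p $ snd p)\<^sup>2)\<^sup>2"
    by (simp add: sq[symmetric] flip: power_mult)
  also have "\<dots> \<le> (\<Sum>p\<in>(UNIV :: ('m \<times> 'n) set). 1\<^sup>2) * (\<Sum>p\<in>UNIV. ((A $ fst p $ snd p)\<^sup>2)\<^sup>2)"
    by (rule Cauchy_Schwarz_ineq_sum)
  also have "\<dots> = real (CARD('m) * CARD('n)) * (\<Sum>i\<in>UNIV. \<Sum>j\<in>UNIV. (A $ i $ j) ^ 4)"
    using pairs[of "\<lambda>x. x ^ 4"] by (simp flip: power_mult)
  finally show ?thesis .
qed

text \<open>The cube is dominated through \<open>x^3 \<le> 1 + x^4\<close>, and the fourth power of
  the norm by entrywise fourth moments.\<close>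

lemma (in prob_space) integrable_norm_cube_std_normal:
  fixes N :: "'a \<Rightarrow> real^'n^'m"
  assumes normal: "\<And>i j. distributed M lborel (\<lambda>\<omega>. N \<omega> $ i $ j) std_normal_density"
  shows "integrable M (\<lambda>\<omega>. norm (N \<omega>) ^ 3)"
proof -
  have "(\<lambda>\<omega>. N \<omega> $ i $ j) \<in> borel_measurable M" for i j
    using distributed_measurable[OF normal] by simp
  then have [measurable]: "N \<in> borel_measurable M"
    by (rule borel_measurable_matrix)
  have "integrable M (\<lambda>\<omega>. (N \<omega> $ i $ j) ^ 4)" for i j
    using distributed_integrable[OF normal, of "\<lambda>x. x ^ 4" i j] integrable_std_normal_moment[of 4]
    by simp
  then have bound: "integrable M (\<lambda>\<omega>. 1 + real (CARD('m) * CARD('n)) *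
      (\<Sum>i\<in>UNIV. \<Sum>j\<in>UNIV. (N \<omega> $ i $ j) ^ 4))"
    by (intro Bochner_Integration.integrable_add integrable_mult_right Bochner_Integration.integrable_sum)
      auto
  have cube: "x ^ 3 \<le> 1 + x ^ 4" if "x \<ge> 0" for x :: real
  proof (cases "x \<le> 1")
    case True
    then have "x ^ 3 \<le> 1" using that by (intro power_le_one)
    then show ?thesis by (simp add: add_increasing2)
  next
    case False
    then have "x ^ 3 \<le> x ^ 4" by (intro power_increasing) auto
    then show ?thesis by simp
  qed
  have "norm (norm (N \<omega>) ^ 3) \<le> norm (1 + real (CARD('m) * CARD('n)) *
      (\<Sum>i\<in>UNIV. \<Sum>j\<in>UNIV. (N \<omega> $ i $ j) ^ 4))" for \<omega>
    using cube[of "norm (N \<omega>)"] norm_matrix_power4_le[of "N \<omega>"] by simp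
  then show ?thesis
    by (intro Bochner_Integration.integrable_bound[OF bound]) auto
qed

lemma matrix_inner_transpose_expand:
  fixes T N :: "real^'n^'n"
  shows "inner (transpose T ** N) (transpose (transpose T ** N))
    = (\<Sum>i\<in>UNIV. \<Sum>j\<in>UNIV. \<Sum>k\<in>UNIV. \<Sum>l\<in>UNIV. (T $ k $ i * T $ l $ j) * (N $ k $ j * N $ l $ i))"
  unfolding inner_vec_def matrix_matrix_mult_def transpose_def
  by (simp add: sum_product mult_ac) (rule sum.swap)

text \<open>The nine entries have unit second moment. In the expanded inner product with the
  transpose only the terms with \<open>k = l\<close> and \<open>i = j\<close> survive, leaving
  \<open>inner T T = 3\<close>, so the skew part has mean square \<open>(9 - 3) / 2\<close>.\<close>

lemma (in prob_space) std_normal_matrix_moments: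
  fixes N :: "'a \<Rightarrow> real^3^3"
  assumes indep: "indep_vars (\<lambda>_. borel) (\<lambda>(i, j) \<omega>. N \<omega> $ i $ j) UNIV"
    and normal: "\<And>i j. distributed M lborel (\<lambda>\<omega>. N \<omega> $ i $ j) std_normal_density"
    and T: "orthogonal_matrix T"
  shows "has_bochner_integral M (\<lambda>\<omega>. (norm (N \<omega>))\<^sup>2) 9"
    and "has_bochner_integral M (\<lambda>\<omega>. (norm (skew_part (transpose T ** N \<omega>)))\<^sup>2) 3"
proof -
  have prod: "has_bochner_integral M (\<lambda>\<omega>. N \<omega> $ i $ j * N \<omega> $ k $ l) (of_bool (i = k \<and> j = l))"
    for i j k l
    using indep_std_normal_product[OF indep, of "(i, j)" "(k, l)"] normal by (simp add: case_prod_beta)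
  have norm_eq: "(\<lambda>\<omega>. (norm (N \<omega>))\<^sup>2) = (\<lambda>\<omega>. \<Sum>i\<in>UNIV. \<Sum>j\<in>UNIV. N \<omega> $ i $ j * N \<omega> $ i $ j)"
    by (simp add: norm_matrix_eq_Frobenius sum_nonneg power2_eq_square)
  have "has_bochner_integral M (\<lambda>\<omega>. (norm (N \<omega>))\<^sup>2) (\<Sum>i\<in>(UNIV::3 set). \<Sum>j\<in>(UNIV::3 set). of_bool (i = i \<and> j = j))"
    unfolding norm_eq by (intro has_bochner_integral_sum prod)
  then show norm9: "has_bochner_integral M (\<lambda>\<omega>. (norm (N \<omega>))\<^sup>2) 9"
    by simp
  have "has_bochner_integral M (\<lambda>\<omega>. inner (transpose T ** N \<omega>) (transpose (transpose T ** N \<omega>)))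
    (\<Sum>i\<in>UNIV. \<Sum>j\<in>UNIV. \<Sum>k\<in>UNIV. \<Sum>l\<in>UNIV. (T $ k $ i * T $ l $ j) * of_bool (k = l \<and> j = i))"
    unfolding matrix_inner_transpose_expand
    by (intro has_bochner_integral_sum has_bochner_integral_mult_right prod)
  also have "(\<Sum>i\<in>UNIV. \<Sum>j\<in>UNIV. \<Sum>k\<in>UNIV. \<Sum>l\<in>UNIV. (T $ k $ i * T $ l $ j) * of_bool (k = l \<and> j = i))
    = inner T T"
    by (simp add: inner_vec_def sum_3)
  also have "inner T T = 3"
    using norm_orthogonal_matrix[OF T] by (simp flip: power2_norm_eq_inner)
  finally have "has_bochner_integral M (\<lambda>\<omega>. ((norm (N \<omega>))\<^sup>2
      - inner (transpose T ** N \<omega>) (transpose (transpose T ** N \<omega>))) / 2) ((9 - 3) / 2)"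
    using norm9 by (intro has_bochner_integral_divide_zero has_bochner_integral_diff)
  then show "has_bochner_integral M (\<lambda>\<omega>. (norm (skew_part (transpose T ** N \<omega>)))\<^sup>2) 3"
    using T by (simp add: norm_skew_part_sq norm_orthogonal_mult)
qed

text \<open>The pointwise cubic bound is integrated: its leading term is \<open>\<sigma>^2\<close>
  times the squared skew part, of mean 3, and the constant \<open>K\<close> does not depend on
  \<open>\<sigma>\<close>.\<close>

lemma (in prob_space) svdo_plus_error_expansion:
  fixes N :: "'a \<Rightarrow> real^3^3"
  assumes indep: "indep_vars (\<lambda>_. borel) (\<lambda>(i, j) \<omega>. N \<omega> $ i $ j) UNIV"
    and normal: "\<And>i j. distributed M lborel (\<lambda>\<omega>. N \<omega> $ i $ j) std_normal_density"
    and T: "rotation_matrix T"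
  obtains K where "K \<ge> 0"
    "\<And>\<sigma>. \<sigma> > 0 \<Longrightarrow> \<bar>expectation (\<lambda>\<omega>. (norm (svdo_plus (T + \<sigma> *\<^sub>R N \<omega>) - T))\<^sup>2) - 3 * \<sigma>\<^sup>2\<bar> \<le> K * \<sigma> ^ 3"
proof -
  obtain C where "C \<ge> 0" and C:
    "\<And>F. \<bar>(norm (svdo_plus (T + F) - T))\<^sup>2 - (norm (skew_part (transpose T ** F)))\<^sup>2\<bar> \<le> C * norm F ^ 3"
    using svdo_plus_expansion[OF T] by blast
  have "(\<lambda>\<omega>. N \<omega> $ i $ j) \<in> borel_measurable M" for i j
    using distributed_measurable[OF normal] by simp
  then have [measurable]: "N \<in> borel_measurable M"
    by (rule borel_measurable_matrix)
  note [measurable] = borel_measurable_svdo_plus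
  define q where "q \<omega> = (norm (skew_part (transpose T ** N \<omega>)))\<^sup>2" for \<omega>
  have "has_bochner_integral M q 3"
    using std_normal_matrix_moments(2)[OF indep normal] T
    by (simp add: q_def[abs_def] rotation_matrix_def)
  then have q: "integrable M q" "expectation q = 3"
    by (simp_all add: has_bochner_integral_iff)
  note cube = integrable_norm_cube_std_normal[OF normal]
  define K where "K = C * expectation (\<lambda>\<omega>. norm (N \<omega>) ^ 3)"
  have "\<bar>expectation (\<lambda>\<omega>. (norm (svdo_plus (T + \<sigma> *\<^sub>R N \<omega>) - T))\<^sup>2) - 3 * \<sigma>\<^sup>2\<bar> \<le> K * \<sigma> ^ 3"
    if "\<sigma> > 0" for \<sigma>
  proof -
    define D where "D \<omega> = (norm (svdo_plus (T + \<sigma> *\<^sub>R N \<omega>) - T))\<^sup>2" for \<omega>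
    have D_meas: "D \<in> borel_measurable M"
      unfolding D_def[abs_def] by measurable
    have diff: "\<bar>D \<omega> - \<sigma>\<^sup>2 * q \<omega>\<bar> \<le> C * \<sigma> ^ 3 * norm (N \<omega>) ^ 3" for \<omega>
      using C[of "\<sigma> *\<^sub>R N \<omega>"] that
      by (simp add: D_def q_def matrix_scalar_ac skew_part_scaleR power_mult_distrib mult_ac
          flip: scalar_matrix_assoc)
    have bound: "integrable M (\<lambda>\<omega>. C * \<sigma> ^ 3 * norm (N \<omega>) ^ 3)"
      using cube by simp
    have int: "integrable M (\<lambda>\<omega>. D \<omega> - \<sigma>\<^sup>2 * q \<omega>)"
    proof (rule Bochner_Integration.integrable_bound[OF bound])
      show "(\<lambda>\<omega>. D \<omega> - \<sigma>\<^sup>2 * q \<omega>) \<in> borel_measurable M"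
        using D_meas q(1) by measurable
      show "AE \<omega> in M. norm (D \<omega> - \<sigma>\<^sup>2 * q \<omega>) \<le> norm (C * \<sigma> ^ 3 * norm (N \<omega>) ^ 3)"
        using order_trans[OF diff abs_ge_self] by (intro AE_I2) simp
    qed
    \<comment> \<open>Integrability of \<open>D\<close> is recovered from that of the dominated
      difference and of \<open>q\<close>.\<close>
    have "integrable M (\<lambda>\<omega>. (D \<omega> - \<sigma>\<^sup>2 * q \<omega>) + \<sigma>\<^sup>2 * q \<omega>)"
      using int q(1) by (intro Bochner_Integration.integrable_add) auto
    then have "expectation D - 3 * \<sigma>\<^sup>2 = expectation (\<lambda>\<omega>. D \<omega> - \<sigma>\<^sup>2 * q \<omega>)"
      using q by simp
    also have "\<bar>\<dots>\<bar> \<le> expectation (\<lambda>\<omega>. \<bar>D \<omega> - \<sigma>\<^sup>2 * q \<omega>\<bar>)"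
      by (rule integral_abs_bound)
    also have "\<dots> \<le> expectation (\<lambda>\<omega>. C * \<sigma> ^ 3 * norm (N \<omega>) ^ 3)"
      using int bound diff by (intro integral_mono) auto
    also have "\<dots> = K * \<sigma> ^ 3"
      by (simp add: K_def)
    finally show ?thesis by (simp add: D_def[abs_def])
  qed
  moreover have "K \<ge> 0"
    using \<open>C \<ge> 0\<close> by (simp add: K_def)
  ultimately show ?thesis using that by blast
qed

section \<open>Asymptotics of the mean squared error and its ratio\<close>

theorem corollary2:
  fixes P :: "'a measure" and N :: "'a \<Rightarrow> real^3^3" and Rstar :: "real^3^3"
  assumes "prob_space P"
    and indep: "prob_space.indep_vars P (\<lambda>_. borel) (\<lambda>(i, j) \<omega>. N \<omega> $ i $ j) UNIV"
    and normal: "\<And>i j. distributed P lborel (\<lambda>\<omega>. N \<omega> $ i $ j) std_normal_density"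
    and "rotation_matrix Rstar"
  shows
    "let M = (\<lambda>\<sigma> \<omega>. Rstar + \<sigma> *\<^sub>R N \<omega>);
         err = (\<lambda>\<sigma>. \<integral>\<omega>. (norm (svdo_plus (M \<sigma> \<omega>) - Rstar))\<^sup>2 \<partial>P);
         eps2 = (\<lambda>\<sigma>. \<integral>\<omega>. (norm (M \<sigma> \<omega> - Rstar))\<^sup>2 \<partial>P)
     in (\<lambda>\<sigma>. err \<sigma> - 3 * \<sigma>\<^sup>2) \<in> O[at_right 0](\<lambda>\<sigma>. \<sigma> ^ 3) \<and>
        (\<forall>\<sigma>>0. eps2 \<sigma> = 9 * \<sigma>\<^sup>2) \<and>
        (\<lambda>\<sigma>. err \<sigma> / eps2 \<sigma> - 1 / 3) \<in> O[at_right 0](\<lambda>\<sigma>. \<sigma>) \<and>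
        (\<exists>\<sigma>\<^sub>0>0. \<forall>\<sigma>. 0 < \<sigma> \<and> \<sigma> < \<sigma>\<^sub>0 \<longrightarrow> err \<sigma> \<le> eps2 \<sigma>)"
proof -
  interpret prob_space P by fact
  define err where "err \<sigma> = expectation (\<lambda>\<omega>. (norm (svdo_plus (Rstar + \<sigma> *\<^sub>R N \<omega>) - Rstar))\<^sup>2)" for \<sigma>
  define eps2 where "eps2 \<sigma> = expectation (\<lambda>\<omega>. (norm (Rstar + \<sigma> *\<^sub>R N \<omega> - Rstar))\<^sup>2)" for \<sigma>
  obtain K where "K \<ge> 0" and K: "\<And>\<sigma>. \<sigma> > 0 \<Longrightarrow> \<bar>err \<sigma> - 3 * \<sigma>\<^sup>2\<bar> \<le> K * \<sigma> ^ 3"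
    using svdo_plus_error_expansion[OF indep normal \<open>rotation_matrix Rstar\<close>]
    unfolding err_def by blast
  have "has_bochner_integral P (\<lambda>\<omega>. (norm (N \<omega>))\<^sup>2) 9"
    using std_normal_matrix_moments(1)[OF indep normal orthogonal_matrix_id] by simp
  then have eps2: "eps2 \<sigma> = 9 * \<sigma>\<^sup>2" for \<sigma>
    by (simp add: eps2_def power_mult_distrib has_bochner_integral_iff)
  have pos: "\<forall>\<^sub>F \<sigma> :: real in at_right 0. \<sigma> > 0"
    by (rule eventually_at_right_less)
  have "(\<lambda>\<sigma>. err \<sigma> - 3 * \<sigma>\<^sup>2) \<in> O[at_right 0](\<lambda>\<sigma>. \<sigma> ^ 3)"
    using pos by (intro bigoI[of _ K]) (auto elim!: eventually_mono dest: K)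
  moreover have "(\<lambda>\<sigma>. err \<sigma> / eps2 \<sigma> - 1 / 3) \<in> O[at_right 0](\<lambda>\<sigma>. \<sigma>)"
  proof (rule bigoI[of _ "K / 9"])
    show "\<forall>\<^sub>F \<sigma> in at_right 0. norm (err \<sigma> / eps2 \<sigma> - 1 / 3) \<le> K / 9 * norm \<sigma>"
      using pos
    proof eventually_elim
      case (elim \<sigma>)
      have "err \<sigma> / eps2 \<sigma> - 1 / 3 = (err \<sigma> - 3 * \<sigma>\<^sup>2) / (9 * \<sigma>\<^sup>2)"
        using elim by (simp add: eps2 field_simps)
      also have "\<bar>\<dots>\<bar> \<le> K * \<sigma> ^ 3 / (9 * \<sigma>\<^sup>2)"
        using K[OF elim] by (simp add: divide_right_mono)
      also have "\<dots> = K / 9 * \<sigma>"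
        using elim by (simp add: power2_eq_square power3_eq_cube)
      finally show ?case using elim by simp
    qed
  qed
  \<comment> \<open>The leading terms leave a margin of \<open>9 - 3 = 6\<close> times
    \<open>\<sigma>^2\<close>, which absorbs \<open>K * \<sigma>^3\<close> once
    \<open>K * \<sigma> \<le> 6\<close>; the denominator \<open>K + 1\<close> also covers
    \<open>K = 0\<close>.\<close>
  moreover have "err \<sigma> \<le> eps2 \<sigma>" if "0 < \<sigma>" "\<sigma> < 6 / (K + 1)" for \<sigma>
  proof -
    have "K * \<sigma> \<le> 6"
      using that \<open>K \<ge> 0\<close> by (simp add: field_simps)
    then have "K * \<sigma> * \<sigma>\<^sup>2 \<le> 6 * \<sigma>\<^sup>2"
      by (intro mult_right_mono) auto
    then have "K * \<sigma> ^ 3 \<le> 6 * \<sigma>\<^sup>2"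
      by (simp add: power2_eq_square power3_eq_cube)
    with K[OF that(1)] show ?thesis
      unfolding eps2 by linarith
  qed
  moreover have "6 / (K + 1) > 0"
    using \<open>K \<ge> 0\<close> by simp
  ultimately show ?thesis
    unfolding Let_def err_def[symmetric] eps2_def[symmetric] using eps2 by blast
qed

end
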